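(* There is an absolute constant $c>0$ such that the following holds. For $n\ge1$, let $\boldsymbol\sigma=(\sigma_1,\dots,\sigma_n)$ be drawn from the Curie--Weiss model on $\{+1,-1\}^n$ at the critical inverse temperature $\beta=1$ and zero external field, and let $m(\boldsymbol\sigma)=\frac1n\sum_{i=1}^n\sigma_i$ be the magnetization. Then for any $n\ge1$ and $t\ge0$, $$\mathbb{P}\bigl(n^{1/4}|m(\boldsymbol\sigma)|\ge t\bigr)\le 2e^{-ct^4}.$$
   Context: The Curie--Weiss model at inverse temperature $\beta\ge 0$ and zero external field is the probability measure on $\{+1,-1\}^n$ given by $\mu_\beta(\{\boldsymbol\sigma\})=Z_\beta^{-1}\exp\bigl(\frac{\beta}{n}\sum_{1\le i<j\le n}\sigma_i\sigma_j\bigr)$, where $Z_\beta$ is the normalizing constant. *)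

theory Defs
  imports "HOL-Probability.Probability"
begin

text \<open>
  A configuration is an extensional function on the sites \<open>{1..n}\<close>, so that there are
  exactly \<open>2 ^ n\<close> of them.
\<close>

definition spin_configs :: "nat \<Rightarrow> (nat \<Rightarrow> real) set" where
  "spin_configs n = {1..n} \<rightarrow>\<^sub>E {1, -1}"

definition cw_weight :: "real \<Rightarrow> nat \<Rightarrow> (nat \<Rightarrow> real) \<Rightarrow> real" where
  "cw_weight \<beta> n \<sigma> =
     exp (\<beta> / real n * (\<Sum>(i, j)\<in>{(i, j). 1 \<le> i \<and> i < j \<and> j \<le> n}. \<sigma> i * \<sigma> j))"

definition cw_partition :: "real \<Rightarrow> nat \<Rightarrow> real" where
  "cw_partition \<beta> n = (\<Sum>\<sigma>\<in>spin_configs n. cw_weight \<beta> n \<sigma>)"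

definition curie_weiss :: "real \<Rightarrow> nat \<Rightarrow> (nat \<Rightarrow> real) measure" where
  "curie_weiss \<beta> n =
     point_measure (spin_configs n) (\<lambda>\<sigma>. ennreal (cw_weight \<beta> n \<sigma> / cw_partition \<beta> n))"

definition magnetization :: "nat \<Rightarrow> (nat \<Rightarrow> real) \<Rightarrow> real" where
  "magnetization n \<sigma> = (\<Sum>i=1..n. \<sigma> i) / real n"

lemma finite_spin_configs: "finite (spin_configs n)"
  unfolding spin_configs_def by (intro finite_PiE) auto

lemma card_spin_configs: "card (spin_configs n) = 2 ^ n"
  unfolding spin_configs_def by (subst card_PiE) (auto simp: numeral_2_eq_2)

lemma cw_weight_pos: "cw_weight \<beta> n \<sigma> > 0"
  unfolding cw_weight_def by simp

lemma cw_partition_pos: "cw_partition \<beta> n > 0"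
proof -
  have "spin_configs n \<noteq> {}"
    using card_spin_configs[of n] by force
  then show ?thesis
    unfolding cw_partition_def by (intro sum_pos finite_spin_configs cw_weight_pos)
qed

lemma space_curie_weiss: "space (curie_weiss \<beta> n) = spin_configs n"
  unfolding curie_weiss_def by (simp add: space_point_measure)

lemma sets_curie_weiss: "sets (curie_weiss \<beta> n) = Pow (spin_configs n)"
  unfolding curie_weiss_def by (simp add: sets_point_measure)

lemma measure_curie_weiss:
  assumes "A \<subseteq> spin_configs n"
  shows "measure (curie_weiss \<beta> n) A = (\<Sum>\<sigma>\<in>A. cw_weight \<beta> n \<sigma>) / cw_partition \<beta> n"
proof -
  have "finite A"
    using assms finite_spin_configs finite_subset by blast
  moreover have "cw_weight \<beta> n \<sigma> / cw_partition \<beta> n \<ge> 0" for \<sigma>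
    using cw_weight_pos[of \<beta> n \<sigma>] cw_partition_pos[of \<beta> n] by simp
  ultimately show ?thesis
    unfolding curie_weiss_def measure_def
    using assms by (simp add: emeasure_point_measure_finite finite_spin_configs
        sum_ennreal sum_nonneg sum_divide_distrib)
qed

lemma prob_space_curie_weiss: "prob_space (curie_weiss \<beta> n)"
proof (rule prob_spaceI)
  have nn: "cw_weight \<beta> n \<sigma> / cw_partition \<beta> n \<ge> 0" for \<sigma>
    using cw_weight_pos[of \<beta> n \<sigma>] cw_partition_pos[of \<beta> n] by simp
  have "(\<Sum>\<sigma>\<in>spin_configs n. cw_weight \<beta> n \<sigma> / cw_partition \<beta> n) = 1"
    using cw_partition_pos[of \<beta> n]
    by (simp add: sum_divide_distrib[symmetric] cw_partition_def[symmetric])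
  then show "emeasure (curie_weiss \<beta> n) (space (curie_weiss \<beta> n)) = 1"
    unfolding space_curie_weiss unfolding curie_weiss_def
    by (simp add: emeasure_point_measure_finite finite_spin_configs sum_ennreal nn)
qed

end

theory Submission
  imports Defs
begin

text \<open>
  Put \<open>S = \<Sum>\<^sub>i \<sigma>\<^sub>i\<close>. At \<open>\<beta> = 1\<close> the weight is a constant times \<open>exp (S\<^sup>2 / 2n)\<close>, so the number \<open>k\<close>
  of plus spins has law proportional to \<open>w k = (n choose k) exp ((2k - n)\<^sup>2 / 2n)\<close>.
  With \<open>y = (2k + 1 - n) / (n + 1)\<close>, the ratio \<open>w (k + 1) / w k\<close> equals
  \<open>(1 - y) / (1 + y) exp (2y + 2y / n)\<close>, which is at most \<open>exp (2 / n - 2y\<^sup>3 / 3)\<close> when \<open>k \<ge> n / 2\<close>: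
  at criticality the linear terms cancel and the cubic one remains. Multiplying \<open>m \<le> n / 2\<close> such
  ratios gives \<open>w (k + m) \<le> e w k exp (- m\<^sup>4 / 12n\<^sup>3)\<close>. Shifting the whole tail \<open>S \<ge> 2m\<close> down by \<open>2m\<close>
  thus compares it with the total mass, and no asymptotics of the partition function are needed.
\<close>

section \<open>An elementary bound with a cubic correction\<close>

text \<open>Minus the logarithm of the left side is 2 artanh y = 2y + 2y^3/3 + 2y^5/5 + ..., and the
  bound drops the nonnegative terms from y^5 on. Instead of the series, the proof uses that the
  dropped remainder \<open>g\<close> has derivative 2x^4 / (1 - x^2) and vanishes at 0.\<close>

lemma ratio_le_exp_cubic:
  fixes y :: real
  assumes "0 \<le> y" "y < 1"
  shows "(1 - y) / (1 + y) \<le> exp (- 2 * y - 2 / 3 * y ^ 3)"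
proof -
  define g where "g = (\<lambda>x::real. ln (1 + x) - ln (1 - x) - 2 * x - 2 / 3 * x ^ 3)"
  have "g 0 \<le> g y"
  proof (rule DERIV_nonneg_imp_nondecreasing[OF assms(1)])
    fix x :: real assume x: "0 \<le> x" "x \<le> y"
    then have x1: "x < 1" using assms by simp
    have d: "(g has_real_derivative (1 / (1 + x) + 1 / (1 - x) - 2 - 2 * x ^ 2)) (at x)"
      unfolding g_def using x x1 by (auto intro!: derivative_eq_intros)
    have "x ^ 2 < 1" using x x1 by (simp add: power_less_one_iff abs_square_less_1)
    moreover have "1 / (1 + x) + 1 / (1 - x) - 2 - 2 * x ^ 2 = 2 * x ^ 4 / (1 - x ^ 2)"
      if "x\<^sup>2 < 1"
    proof -
      have "1 - x\<^sup>2 \<noteq> 0" "1 + x \<noteq> 0" "1 - x \<noteq> 0" using that x x1 by auto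
      moreover have "1 - x\<^sup>2 = (1 + x) * (1 - x)" by (simp add: power2_eq_square algebra_simps)
      ultimately show ?thesis
        by (simp add: divide_simps) (simp add: algebra_simps power2_eq_square power4_eq_xxxx)
    qed
    ultimately have "1 / (1 + x) + 1 / (1 - x) - 2 - 2 * x ^ 2 \<ge> 0" by simp
    with d show "\<exists>z. (g has_real_derivative z) (at x) \<and> 0 \<le> z" by blast
  qed
  then have "ln ((1 - y) / (1 + y)) \<le> - 2 * y - 2 / 3 * y ^ 3"
    using assms by (simp add: g_def ln_div)
  then show ?thesis
    using assms by (metis add_pos_nonneg diff_gt_0_iff_gt divide_pos_pos exp_le_cancel_iff
        exp_ln zero_less_one)
qed

section \<open>Reduction to the number of plus spins\<close>

lemma sum_pairs_less:
  fixes f :: "nat \<Rightarrow> real"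
  shows "2 * (\<Sum>(i, j)\<in>{(i, j). 1 \<le> i \<and> i < j \<and> j \<le> n}. f i * f j)
    = (\<Sum>i=1..n. f i)\<^sup>2 - (\<Sum>i=1..n. (f i)\<^sup>2)"
proof (induction n)
  case 0
  have "{(i, j). 1 \<le> i \<and> i < j \<and> j \<le> (0::nat)} = {}" by auto
  then show ?case by (simp only:) simp
next
  case (Suc n)
  let ?P = "\<lambda>n. {(i, j). (1::nat) \<le> i \<and> i < j \<and> j \<le> n}"
  have fin: "finite (?P n)"
    by (rule finite_subset[of _ "{..n} \<times> {..n}"]) auto
  have split: "?P (Suc n) = ?P n \<union> (\<lambda>i. (i, Suc n)) ` {1..n}"
    by (auto simp: image_iff)
  have "(\<Sum>(i, j)\<in>?P (Suc n). f i * f j)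
      = (\<Sum>(i, j)\<in>?P n. f i * f j) + (\<Sum>i=1..n. f i) * f (Suc n)"
    unfolding split using fin
    by (subst sum.union_disjoint) (auto simp: sum.reindex inj_on_def sum_distrib_right)
  then show ?case
    using Suc.IH by (simp add: power2_eq_square algebra_simps)
qed

lemma sum_Pow_card:
  fixes h :: "nat \<Rightarrow> real"
  assumes "finite A"
  shows "(\<Sum>B\<in>Pow A. h (card B)) = (\<Sum>k\<le>card A. real (card A choose k) * h k)"
proof -
  have "(\<Sum>B\<in>Pow A. h (card B)) = (\<Sum>k\<le>card A. \<Sum>B\<in>{B \<in> Pow A. card B = k}. h (card B))"
    using assms by (intro sum.group[symmetric]) (auto intro: card_mono)
  also have "\<dots> = (\<Sum>k\<le>card A. real (card A choose k) * h k)"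
    using n_subsets[OF assms] by (intro sum.cong) (auto simp: Pow_def)
  finally show ?thesis .
qed

text \<open>A configuration is determined by its set A of plus sites, and its total spin is 2|A| -
  n. Grouping the sets A by size produces the binomial coefficients.\<close>

lemma sum_spin_configs:
  fixes g :: "real \<Rightarrow> real"
  shows "(\<Sum>\<sigma>\<in>spin_configs n. g (\<Sum>i=1..n. \<sigma> i))
    = (\<Sum>k\<le>n. real (n choose k) * g (2 * real k - real n))"
proof -
  \<comment> \<open>The restricted lambda makes \<open>s A\<close> equal \<open>undefined\<close>
    off the sites, as the extensional configurations require.\<close>
  define s :: "nat set \<Rightarrow> nat \<Rightarrow> real"
    where "s = (\<lambda>A. \<lambda>i\<in>{1..n}. if i \<in> A then 1 else - 1)"
  have bij: "bij_betw s (Pow {1..n}) (spin_configs n)"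
  proof (rule bij_betwI[where g = "\<lambda>\<sigma>. {i \<in> {1..n}. \<sigma> i = 1}"])
    show "s \<in> Pow {1..n} \<rightarrow> spin_configs n"
      by (auto simp: s_def spin_configs_def)
    show "(\<lambda>\<sigma>. {i \<in> {1..n}. \<sigma> i = 1}) \<in> spin_configs n \<rightarrow> Pow {1..n}" by auto
    show "{i \<in> {1..n}. s A i = 1} = A" if "A \<in> Pow {1..n}" for A
      using that by (auto simp: s_def split: if_splits)
    show "s {i \<in> {1..n}. \<sigma> i = 1} = \<sigma>" if "\<sigma> \<in> spin_configs n" for \<sigma>
    proof
      fix i
      show "s {i \<in> {1..n}. \<sigma> i = 1} i = \<sigma> i"
        using that PiE_mem[of \<sigma> "{1..n}" "\<lambda>_. {1, -1}" i]
          PiE_arb[of \<sigma> "{1..n}" "\<lambda>_. {1, -1}" i]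
        by (cases "i \<in> {1..n}") (auto simp: s_def spin_configs_def)
    qed
  qed
  have sum_s: "(\<Sum>i=1..n. s A i) = 2 * real (card A) - real n" if "A \<subseteq> {1..n}" for A
  proof -
    have "(\<Sum>i=1..n. s A i) = (\<Sum>i=1..n. 2 * indicator A i - 1)"
      by (intro sum.cong) (auto simp: s_def)
    also have "\<dots> = 2 * real (card ({1..n} \<inter> A)) - real n"
      by (simp add: sum_subtractf sum_distrib_left[symmetric] sum_indicator_eq_card Int_def indicator_def)
    finally show ?thesis using that by (simp add: Int_absorb1)
  qed
  have "(\<Sum>\<sigma>\<in>spin_configs n. g (\<Sum>i=1..n. \<sigma> i)) = (\<Sum>A\<in>Pow {1..n}. g (\<Sum>i=1..n. s A i))"
    by (rule sum.reindex_bij_betw[OF bij, symmetric])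
  also have "\<dots> = (\<Sum>A\<in>Pow {1..n}. g (2 * real (card A) - real n))"
  proof (rule sum.cong[OF refl])
    fix A assume "A \<in> Pow {1..n}"
    then show "g (\<Sum>i=1..n. s A i) = g (2 * real (card A) - real n)"
      using sum_s[of A] by simp
  qed
  also have "\<dots> = (\<Sum>k\<le>n. real (n choose k) * g (2 * real k - real n))"
    using sum_Pow_card[of "{1..n}" "\<lambda>k. g (2 * real k - real n)"] by simp
  finally show ?thesis .
qed

text \<open>The pair sum is half of the squared total spin minus the diagonal. Since each spin
  squares to 1, the diagonal is n and yields the constant factor exp (-1/2).\<close>

lemma cw_weight_critical:
  assumes "\<sigma> \<in> spin_configs n" "n \<ge> 1"
  shows "cw_weight 1 n \<sigma> = exp (- 1 / 2) * exp ((\<Sum>i=1..n. \<sigma> i)\<^sup>2 / (2 * real n))"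
proof -
  have "(\<sigma> i)\<^sup>2 = 1" if "i \<in> {1..n}" for i
    using assms(1) that PiE_mem[of \<sigma> "{1..n}" "\<lambda>_. {1, -1}" i]
    by (auto simp: spin_configs_def)
  then have "(\<Sum>i=1..n. (\<sigma> i)\<^sup>2) = real n" by simp
  then have "(\<Sum>(i, j)\<in>{(i, j). 1 \<le> i \<and> i < j \<and> j \<le> n}. \<sigma> i * \<sigma> j)
      = ((\<Sum>i=1..n. \<sigma> i)\<^sup>2 - real n) / 2"
    using sum_pairs_less[where f = \<sigma> and n = n] by simp
  then show ?thesis
    using assms(2) by (simp add: cw_weight_def exp_add[symmetric] field_simps)
qed

text \<open>The \<open>w k\<close> of the overview: the total weight of the configurations with k
  plus spins, up to the factor exp (-1/2), which normalization cancels.\<close>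

definition cw_level :: "nat \<Rightarrow> nat \<Rightarrow> real" where
  "cw_level n k = real (n choose k) * exp ((2 * real k - real n)\<^sup>2 / (2 * real n))"

lemma cw_level_nonneg: "cw_level n k \<ge> 0"
  by (simp add: cw_level_def)

lemma cw_level_sum_pos: "(\<Sum>k\<le>n. cw_level n k) > 0"
  by (intro sum_pos) (auto simp: cw_level_def)

text \<open>Invariance of the model under the global spin flip.\<close>

lemma cw_level_reflect: "k \<le> n \<Longrightarrow> cw_level n (n - k) = cw_level n k"
  by (simp add: cw_level_def binomial_symmetric[symmetric] of_nat_diff power2_eq_square algebra_simps)

lemma measure_curie_weiss_critical:
  assumes "n \<ge> 1"
  shows "measure (curie_weiss 1 n) {\<sigma> \<in> space (curie_weiss 1 n). P (\<Sum>i=1..n. \<sigma> i)}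
    = (\<Sum>k | k \<le> n \<and> P (2 * real k - real n). cw_level n k) / (\<Sum>k\<le>n. cw_level n k)"
proof -
  \<comment> \<open>The predicate \<open>Q\<close> stays general: \<open>P\<close> gives the
    numerator and the constant truth gives the partition function.\<close>
  have *: "(\<Sum>\<sigma>\<in>{\<sigma> \<in> spin_configs n. Q (\<Sum>i=1..n. \<sigma> i)}. cw_weight 1 n \<sigma>)
      = exp (- 1 / 2) * (\<Sum>k | k \<le> n \<and> Q (2 * real k - real n). cw_level n k)" for Q
  proof -
    define h where "h = (\<lambda>x. if Q x then exp (- 1 / 2) * exp (x\<^sup>2 / (2 * real n)) else 0)"
    have "(\<Sum>\<sigma>\<in>{\<sigma> \<in> spin_configs n. Q (\<Sum>i=1..n. \<sigma> i)}. cw_weight 1 n \<sigma>)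
       = (\<Sum>\<sigma>\<in>spin_configs n. if Q (\<Sum>i=1..n. \<sigma> i) then cw_weight 1 n \<sigma> else 0)"
      by (rule sum.inter_filter[OF finite_spin_configs])
    also have "\<dots> = (\<Sum>\<sigma>\<in>spin_configs n. h (\<Sum>i=1..n. \<sigma> i))"
      unfolding h_def using assms by (intro sum.cong refl if_cong cw_weight_critical) auto
    also have "\<dots> = (\<Sum>k\<le>n. if Q (2 * real k - real n) then exp (- 1 / 2) * cw_level n k else 0)"
      unfolding sum_spin_configs by (intro sum.cong) (auto simp: cw_level_def h_def)
    also have "\<dots> = (\<Sum>k\<in>{k \<in> {..n}. Q (2 * real k - real n)}. exp (- 1 / 2) * cw_level n k)"
      by (intro sum.inter_filter[symmetric]) simp
    finally show ?thesis by (simp add: sum_distrib_left)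
  qed
  have "cw_partition 1 n = exp (- 1 / 2) * (\<Sum>k\<le>n. cw_level n k)"
    using *[of "\<lambda>_. True"] by (simp add: cw_partition_def atMost_def)
  then show ?thesis
    using *[of P] by (simp add: space_curie_weiss measure_curie_weiss)
qed

section \<open>Decay of the level weights above the centre\<close>

lemma cw_level_Suc_le:
  assumes "n \<le> 2 * k" "k < n"
  shows "cw_level n (Suc k)
    \<le> cw_level n k * exp (2 / real n - 2 / 3 * ((2 * real k + 1 - real n) / (real n + 1)) ^ 3)"
proof -
  \<comment> \<open>With this \<open>y\<close>, (1 - y) / (1 + y) is exactly the binomial ratio (n -
    k) / (k + 1), and x + 1 = (n + 1) y for the total spin \<open>x\<close> at level k.\<close>
  define y where "y = (2 * real k + 1 - real n) / (real n + 1)"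
  define x where "x = 2 * real k - real n"
  have n: "real n > 0" using assms by simp
  have y: "0 \<le> y" "y < 1" using assms by (auto simp: y_def)
  have "real (n choose Suc k) * (real k + 1) = real (n choose k) * (real n - real k)"
    using binomial_absorb_comp[of n k] binomial_absorption[of k "n"] assms
    by (metis (no_types, lifting) Suc_eq_plus1 binomial_absorption less_imp_le mult.commute
        of_nat_1 of_nat_add of_nat_diff of_nat_mult)
  moreover have "(1 - y) / (1 + y) = (real n - real k) / (real k + 1)"
    by (simp add: y_def divide_simps) (simp add: algebra_simps)
  moreover have "real (n choose Suc k) = real (n choose Suc k) * (real k + 1) / (real k + 1)"
    by simp
  ultimately have choose: "real (n choose Suc k) = real (n choose k) * ((1 - y) / (1 + y))"
    by (metis times_divide_eq_right)
  \<comment> \<open>One more plus spin raises the exponent by 2(x + 1)/n = 2y(n + 1)/n. The part 2y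
    cancels against the linear term of the ratio bound.\<close>
  have "(x + 2)\<^sup>2 / (2 * real n) = x\<^sup>2 / (2 * real n) + (2 * y + 2 * y / real n)"
    using n by (simp add: y_def x_def divide_simps) (simp add: power2_eq_square algebra_simps)
  then have "cw_level n (Suc k)
      = cw_level n k * ((1 - y) / (1 + y) * exp (2 * y + 2 * y / real n))"
    by (simp add: cw_level_def choose exp_add x_def algebra_simps)
  also have "(1 - y) / (1 + y) * exp (2 * y + 2 * y / real n)
      \<le> exp (- 2 * y - 2 / 3 * y ^ 3) * exp (2 * y + 2 * y / real n)"
    using ratio_le_exp_cubic[OF y] by (intro mult_right_mono) auto
  also have "\<dots> = exp (2 * y / real n - 2 / 3 * y ^ 3)"
    by (simp add: exp_add[symmetric])
  also have "\<dots> \<le> exp (2 / real n - 2 / 3 * y ^ 3)"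
    using y n by (simp add: divide_right_mono)
  finally show ?thesis
    by (simp add: y_def mult_left_mono cw_level_nonneg)
qed

text \<open>The step from k + i to k + i + 1 gains at least the cube of (2i + 1)/(n + 1), because 2k
  >= n. As (2i + 1)^3 >= (i + 1)^4 - i^4, these gains telescope to m^4.\<close>

lemma cw_level_add_le:
  assumes "n \<le> 2 * k" "k + m \<le> n"
  shows "cw_level n (k + m)
    \<le> cw_level n k * exp (2 * real m / real n - 2 / 3 * real m ^ 4 / (real n + 1) ^ 3)"
  using assms(2)
proof (induction m)
  case 0
  then show ?case by simp
next
  case (Suc m)
  let ?E = "2 / real n - 2 / 3 * ((2 * real (k + m) + 1 - real n) / (real n + 1)) ^ 3"
  have "(real m + 1) ^ 4 - real m ^ 4 \<le> (2 * real m + 1) ^ 3"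
    by (simp add: power4_eq_xxxx power3_eq_cube algebra_simps)
  also have "\<dots> \<le> (2 * real (k + m) + 1 - real n) ^ 3"
    using assms(1) by (intro power_mono) auto
  finally have "((real m + 1) ^ 4 - real m ^ 4) / (real n + 1) ^ 3
      \<le> ((2 * real (k + m) + 1 - real n) / (real n + 1)) ^ 3"
    unfolding power_divide by (intro divide_right_mono) auto
  then have E: "2 * real m / real n - 2 / 3 * real m ^ 4 / (real n + 1) ^ 3 + ?E
      \<le> 2 * real (Suc m) / real n - 2 / 3 * real (Suc m) ^ 4 / (real n + 1) ^ 3"
    by (simp add: diff_divide_distrib add_divide_distrib algebra_simps)
  have "cw_level n (k + Suc m) \<le> cw_level n (k + m) * exp ?E"
    using cw_level_Suc_le[of n "k + m"] assms(1) Suc.prems by simp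
  also have "\<dots> \<le> cw_level n k
      * exp (2 * real m / real n - 2 / 3 * real m ^ 4 / (real n + 1) ^ 3) * exp ?E"
    using Suc by (intro mult_right_mono) auto
  also have "\<dots> = cw_level n k
      * exp (2 * real m / real n - 2 / 3 * real m ^ 4 / (real n + 1) ^ 3 + ?E)"
    by (simp only: exp_add mult.assoc)
  also have "\<dots> \<le> cw_level n k
      * exp (2 * real (Suc m) / real n - 2 / 3 * real (Suc m) ^ 4 / (real n + 1) ^ 3)"
    using E by (intro mult_left_mono cw_level_nonneg) simp
  finally show ?case .
qed

text \<open>Here m <= n - k <= n/2, so the accumulated errors 2/n sum to at most 1. From n + 1 <= 2n
  comes the constant (2/3)/8 = 1/12.\<close>

lemma cw_level_shift_le:
  assumes "n \<le> 2 * k" "k + m \<le> n" "n \<ge> 1"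
  shows "cw_level n (k + m) \<le> cw_level n k * exp (1 - real m ^ 4 / (12 * real n ^ 3))"
proof -
  have "2 * real m / real n \<le> 1"
    using assms by (simp add: divide_simps)
  moreover have "real m ^ 4 / (12 * real n ^ 3) \<le> 2 / 3 * real m ^ 4 / (real n + 1) ^ 3"
  proof -
    have "(real n + 1) ^ 3 \<le> (2 * real n) ^ 3"
      using assms(3) by (intro power_mono) auto
    then have "2 / 3 * real m ^ 4 / (2 * real n) ^ 3 \<le> 2 / 3 * real m ^ 4 / (real n + 1) ^ 3"
      by (intro divide_left_mono) (use assms(3) in auto)
    then show ?thesis by (simp add: power_mult_distrib)
  qed
  ultimately have "exp (2 * real m / real n - 2 / 3 * real m ^ 4 / (real n + 1) ^ 3)
      \<le> exp (1 - real m ^ 4 / (12 * real n ^ 3))"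
    by simp
  then show ?thesis
    using cw_level_add_le[OF assms(1,2)]
    by (meson cw_level_nonneg mult_left_mono order_trans)
qed

section \<open>Tail bounds\<close>

lemma cw_level_upper_tail:
  assumes "n \<ge> 1"
  shows "(\<Sum>k | k \<le> n \<and> n + 2 * m \<le> 2 * k. cw_level n k)
    \<le> exp (1 - real m ^ 4 / (12 * real n ^ 3)) * (\<Sum>k\<le>n. cw_level n k)"
proof -
  let ?K = "{k. k + m \<le> n \<and> n \<le> 2 * k}" and ?C = "exp (1 - real m ^ 4 / (12 * real n ^ 3))"
  have "{k. k \<le> n \<and> n + 2 * m \<le> 2 * k} = (\<lambda>k. k + m) ` ?K"
  proof (intro equalityI subsetI)
    fix k assume "k \<in> {k. k \<le> n \<and> n + 2 * m \<le> 2 * k}"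
    then show "k \<in> (\<lambda>k. k + m) ` ?K"
      \<comment> \<open>The natural subtraction is exact, since n + 2m <= 2k forces m <= k.\<close>
      by (intro image_eqI[of _ _ "k - m"]) auto
  qed auto
  then have "(\<Sum>k | k \<le> n \<and> n + 2 * m \<le> 2 * k. cw_level n k) = (\<Sum>k\<in>?K. cw_level n (k + m))"
    by (simp add: sum.reindex inj_on_def)
  also have "\<dots> \<le> (\<Sum>k\<in>?K. ?C * cw_level n k)"
    using cw_level_shift_le assms by (intro sum_mono) (auto simp: mult.commute)
  also have "\<dots> \<le> (\<Sum>k\<le>n. ?C * cw_level n k)"
    by (intro sum_mono2) (auto simp: cw_level_nonneg)
  finally show ?thesis by (simp add: sum_distrib_left)
qed

lemma cw_level_tail:
  assumes "n \<ge> 1"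
  shows "(\<Sum>k | k \<le> n \<and> \<bar>2 * real k - real n\<bar> \<ge> 2 * real m. cw_level n k)
    \<le> 2 * exp (1 - real m ^ 4 / (12 * real n ^ 3)) * (\<Sum>k\<le>n. cw_level n k)"
proof -
  let ?U = "{k. k \<le> n \<and> n + 2 * m \<le> 2 * k}" and ?L = "{k. k \<le> n \<and> 2 * k + 2 * m \<le> n}"
  have fin: "finite ?U" "finite ?L"
    by (auto intro: finite_subset[of _ "{..n}"])
  have "{k. k \<le> n \<and> \<bar>2 * real k - real n\<bar> \<ge> 2 * real m} \<subseteq> ?U \<union> ?L"
    by (auto simp: abs_if split: if_splits)
  then have "(\<Sum>k | k \<le> n \<and> \<bar>2 * real k - real n\<bar> \<ge> 2 * real m. cw_level n k)
      \<le> sum (cw_level n) (?U \<union> ?L)"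
    using fin by (intro sum_mono2) (auto simp: cw_level_nonneg)
  \<comment> \<open>Only an inequality: for m = 0 and even n both tails contain the centre k =
    n/2.\<close>
  also have "\<dots> \<le> sum (cw_level n) ?U + sum (cw_level n) ?L"
    using fin by (simp add: sum_Un sum_nonneg cw_level_nonneg)
  also have "sum (cw_level n) ?L = sum (cw_level n) ?U"
    by (rule sum.reindex_bij_witness[where i = "\<lambda>k. n - k" and j = "\<lambda>k. n - k"])
      (auto simp: cw_level_reflect)
  finally show ?thesis
    using cw_level_upper_tail[OF assms, of m] by simp
qed

text \<open>In terms of the total spin S the event is |S| >= T with T = t n^(3/4). Rounding T/2 down
  to an integer m gives m >= T/4, because T/2 >= 1 when t >= 2. Hence 3072 = 12 * 4^4.\<close>

lemma critical_tail_bound: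
  assumes n: "n \<ge> 1" and t: "t \<ge> 2"
  shows "measure (curie_weiss 1 n)
      {\<sigma> \<in> space (curie_weiss 1 n). real n powr (1/4) * \<bar>magnetization n \<sigma>\<bar> \<ge> t}
    \<le> 2 * exp (1 - t ^ 4 / 3072)"
proof -
  define T where "T = t * real n powr (3/4)"
  define m where "m = nat \<lfloor>T / 2\<rfloor>"
  have n0: "real n > 0" using n by simp
  have "real n powr (3/4) \<ge> 1"
    using n by (intro ge_one_powr_ge_zero) auto
  then have T: "T \<ge> 2" using t mult_mono[of 2 t 1 "real n powr (3/4)"] by (simp add: T_def)
  then have "real m \<ge> 1" "real m = of_int \<lfloor>T / 2\<rfloor>"
    by (auto simp: m_def le_nat_floor)
  then have m: "2 * real m \<le> T" "T / 4 \<le> real m"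
    by linarith+
  have "T ^ 4 = t ^ 4 * real n ^ 3"
    using n0 by (simp add: T_def power_mult_distrib powr_power)
  moreover have "(T / 4) ^ 4 \<le> real m ^ 4"
    using m T by (intro power_mono) auto
  ultimately have "t ^ 4 / 3072 \<le> real m ^ 4 / (12 * real n ^ 3)"
    using n0 by (simp add: field_simps)
  have set_eq: "t \<le> real n powr (1/4) * \<bar>magnetization n \<sigma>\<bar> \<longleftrightarrow> T \<le> \<bar>\<Sum>i=1..n. \<sigma> i\<bar>" for \<sigma>
  proof -
    have "real n = real n powr (1/4) * real n powr (3/4)"
      using n0 by (simp add: powr_add[symmetric])
    then have "real n powr (1/4) * \<bar>magnetization n \<sigma>\<bar> = \<bar>\<Sum>i=1..n. \<sigma> i\<bar> / real n powr (3/4)"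
      using n0 by (simp add: magnetization_def abs_divide divide_simps)
    then show ?thesis
      using n0 by (simp add: T_def pos_le_divide_eq)
  qed
  have "measure (curie_weiss 1 n)
      {\<sigma> \<in> space (curie_weiss 1 n). real n powr (1/4) * \<bar>magnetization n \<sigma>\<bar> \<ge> t}
    = (\<Sum>k | k \<le> n \<and> T \<le> \<bar>2 * real k - real n\<bar>. cw_level n k) / (\<Sum>k\<le>n. cw_level n k)"
    unfolding set_eq by (rule measure_curie_weiss_critical[OF n])
  \<comment> \<open>Since 2m <= T, lowering the threshold to 2m only enlarges the event.\<close>
  also have "\<dots> \<le> (\<Sum>k | k \<le> n \<and> \<bar>2 * real k - real n\<bar> \<ge> 2 * real m. cw_level n k)
      / (\<Sum>k\<le>n. cw_level n k)"
    using m by (intro divide_right_mono sum_mono2) (auto simp: cw_level_nonneg sum_nonneg)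
  also have "\<dots> \<le> 2 * exp (1 - real m ^ 4 / (12 * real n ^ 3))"
    using cw_level_tail[OF n, of m] cw_level_sum_pos[of n] by (simp add: pos_divide_le_eq)
  also have "\<dots> \<le> 2 * exp (1 - t ^ 4 / 3072)"
    using \<open>t ^ 4 / 3072 \<le> real m ^ 4 / (12 * real n ^ 3)\<close> by simp
  finally show ?thesis .
qed

theorem proposition4:
  shows "\<exists>c::real. c > 0 \<and>
    (\<forall>n::nat. \<forall>t::real. n \<ge> 1 \<longrightarrow> t \<ge> 0 \<longrightarrow>
      measure (curie_weiss 1 n)
        {\<sigma> \<in> space (curie_weiss 1 n). real n powr (1/4) * \<bar>magnetization n \<sigma>\<bar> \<ge> t}
      \<le> 2 * exp (- c * t ^ 4))"
\<comment> \<open>Let u = t^4/3072; the exponent of the claim is -u/3, as 9216 = 3 * 3072. For u >=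
  3/2 the prefactor e is absorbed by 1 - u <= -u/3. For u < 3/2 the claim is trivial, as 2 exp
  (-u/3) >= 2(1 - u/3) > 1.\<close>
proof (intro exI[of _ "1 / 9216"] conjI allI impI)
  fix n :: nat and t :: real
  assume n: "n \<ge> 1" and t: "t \<ge> 0"
  let ?p = "measure (curie_weiss 1 n)
    {\<sigma> \<in> space (curie_weiss 1 n). real n powr (1/4) * \<bar>magnetization n \<sigma>\<bar> \<ge> t}"
  show "?p \<le> 2 * exp (- (1 / 9216) * t ^ 4)"
  proof (cases "t ^ 4 / 3072 < 3 / 2")
    case True
    have "?p \<le> 1"
      by (rule prob_space.prob_le_1[OF prob_space_curie_weiss])
    also have "\<dots> \<le> 2 * (1 + - (1 / 9216) * t ^ 4)"
      using True by simp
    also have "\<dots> \<le> 2 * exp (- (1 / 9216) * t ^ 4)"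
      by (intro mult_left_mono exp_ge_add_one_self) auto
    finally show ?thesis .
  next
    case False
    have "t \<ge> 2"
    proof (rule ccontr)
      assume "\<not> t \<ge> 2"
      then have "t ^ 4 \<le> 2 ^ 4" using t by (intro power_mono) auto
      then show False using False by simp
    qed
    then have "?p \<le> 2 * exp (1 - t ^ 4 / 3072)"
      by (rule critical_tail_bound[OF n])
    also have "\<dots> \<le> 2 * exp (- (1 / 9216) * t ^ 4)"
      using False by simp
    finally show ?thesis .
  qed
qed simp

end
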